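(* Let $(\alpha_n,\beta_n)_{n\in\mathbb{Z}}$ be a bilateral Bailey pair relative to $a$, and let $\rho,\sigma$ be complex parameters. Define, for all $n\in\mathbb{Z}$, \[ \alpha'_n=\frac{(\rho,\sigma)_n(a/\rho\sigma)^n}{(a/\rho,a/\sigma)_n}(1-a)\left(\frac{\alpha_n}{1-aq^{2n}}-\frac{aq^{2n-2}\alpha_{n-1}}{1-aq^{2n-2}}\right), \] \[ \beta'_n=\sum_{j\leq n}\frac{(\rho,\sigma)_j(a/\rho\sigma)_{n-j}(a/\rho\sigma)^j}{(q)_{n-j}(a/\rho,a/\sigma)_n}\beta_j . \] Then, subject to convergence conditions on the sequences $\alpha_n,\beta_n$ making all the relevant infinite series absolutely convergent, $(\alpha'_n,\beta'_n)$ is a bilateral Bailey pair relative to $a/q$.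
   Context: Fix complex numbers $a,q$ with $|q|<1$ (parameters generic so that no denominator vanishes). For complex $x$, $(x)_\infty=(x;q)_\infty=\prod_{j\ge0}(1-xq^j)$ and for $k\in\mathbb{Z}$, $(x)_k=(x;q)_k=(x;q)_\infty/(xq^k;q)_\infty$ (so $1/(q)_k=0$ for $k<0$); $(x_1,\dots,x_m)_k=(x_1)_k\cdots(x_m)_k$. A bilateral Bailey pair relative to $c$ is a pair of sequences $(\alpha_n)_{n\in\mathbb{Z}},(\beta_n)_{n\in\mathbb{Z}}$ such that for every $n\in\mathbb{Z}$, $\beta_n=\sum_{j\le n}\frac{\alpha_j}{(q)_{n-j}(cq)_{n+j}}$ (the series being convergent). *)

theory Defs
  imports "HOL-Analysis.Analysis"
begin

definition qpoch_inf :: "complex \<Rightarrow> complex \<Rightarrow> complex" where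
  "qpoch_inf x q = (\<Prod>j. 1 - x * q ^ j)"

text \<open>
  If \<open>x * q powi k\<close> is \<open>q ^ 0\<close>, \<open>q powi (-1)\<close>, \<open>\<dots>\<close> while \<open>qpoch_inf x q \<noteq> 0\<close>, the quotient has a
  pole. HOL division then yields \<open>qpoch x q k = 0\<close>, so the reciprocal \<open>1 / qpoch x q k\<close> is \<open>0\<close>, its
  correct value; in particular \<open>1 / qpoch q q k = 0\<close> for \<open>k < 0\<close>.
\<close>

definition qpoch :: "complex \<Rightarrow> complex \<Rightarrow> int \<Rightarrow> complex" where
  "qpoch x q k = qpoch_inf x q / qpoch_inf (x * q powi k) q"

text \<open>The sum over all integers \<open>j \<le> n\<close> is taken as an ordinary series, with \<open>j = n - k\<close>.\<close>

definition bilateral_bailey_pair ::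
    "complex \<Rightarrow> complex \<Rightarrow> (int \<Rightarrow> complex) \<Rightarrow> (int \<Rightarrow> complex) \<Rightarrow> bool" where
  "bilateral_bailey_pair q c \<alpha> \<beta> \<longleftrightarrow>
     (\<forall>n. (\<lambda>k::nat. let j = n - int k in
            \<alpha> j / (qpoch q q (n - j) * qpoch (c * q) q (n + j))) sums \<beta> n)"

end

theory Submission
  imports Defs
begin

text \<open>
  Inserting \<open>\<beta>\<^sub>j\<close> into \<open>\<beta>'\<^sub>n\<close> and exchanging the sums leaves, for every \<open>r \<le> n\<close>, a finite inner sum
  over \<open>r \<le> j \<le> n\<close>. With \<open>A = a q^(2r)\<close>, it splits into two terminating q-Pfaff-Saalschuetz sums, so the
  coefficient of \<open>\<alpha>\<^sub>r\<close> is a difference \<open>u\<^sub>r - v\<^sub>r\<close> of two products. Summation by parts regroups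
  \<open>\<Sum> \<alpha>\<^sub>r (u\<^sub>r - v\<^sub>r)\<close> as \<open>\<Sum> (\<alpha>\<^sub>r u\<^sub>r - \<alpha>\<^sub>r\<^sub>-\<^sub>1 v\<^sub>r\<^sub>-\<^sub>1)\<close>, the series required for \<open>\<alpha>'\<close>. The boundary term
  \<open>\<alpha>\<^sub>r v\<^sub>r\<close> vanishes as \<open>r\<close> tends to \<open>-\<infinity>\<close>: up to exponential factors \<open>v\<^sub>r\<close> is \<open>1 / (aq)\<^sub>n\<^sub>+\<^sub>r\<close>, and convergence
  of the series for \<open>\<beta>\<^sub>N\<close> at all \<open>N\<close> makes \<open>\<alpha>\<^sub>r / (aq)\<^sub>n\<^sub>+\<^sub>r\<close> decay faster than every exponential.
\<close>

section \<open>Finite q-shifted factorials and terminating sums\<close>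

definition qpoch_fin :: "complex \<Rightarrow> complex \<Rightarrow> nat \<Rightarrow> complex" where
  "qpoch_fin q x m = (\<Prod>j<m. 1 - x * q ^ j)"

lemma qpoch_fin_0 [simp]: "qpoch_fin q x 0 = 1"
  by (simp add: qpoch_fin_def)

lemma qpoch_fin_Suc: "qpoch_fin q x (Suc m) = qpoch_fin q x m * (1 - x * q ^ m)"
  by (simp add: qpoch_fin_def)

lemma qpoch_fin_Suc_shift: "qpoch_fin q x (Suc m) = (1 - x) * qpoch_fin q (x * q) m"
  unfolding qpoch_fin_def prod.lessThan_Suc_shift by (simp add: mult.assoc)

lemma qpoch_fin_q_nonzero:
  assumes "\<And>k. q ^ Suc k \<noteq> 1"
  shows "qpoch_fin q q m \<noteq> 0"
  using assms by (auto simp: qpoch_fin_def)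

text \<open>Telescoping in \<open>i\<close>, with certificate \<open>D\<close>, yields the recurrence of the sum in \<open>m\<close>.\<close>

lemma q_pfaff_saalschuetz:
  fixes q x \<rho> \<sigma> :: complex
  assumes nr: "\<And>k. q ^ Suc k \<noteq> 1"
  shows "(\<Sum>i\<le>m. qpoch_fin q \<rho> i * qpoch_fin q \<sigma> i * qpoch_fin q x (m - i) * x ^ i
            * qpoch_fin q (x * \<rho> * \<sigma> * q ^ i) (m - i) / (qpoch_fin q q i * qpoch_fin q q (m - i)))
         = qpoch_fin q (x * \<rho>) m * qpoch_fin q (x * \<sigma>) m / qpoch_fin q q m"
proof (induction m)
  case 0
  show ?case by simp
next
  case (Suc m)
  define y where "y = x * \<rho> * \<sigma>"
  define t where "t = (\<lambda>m i. qpoch_fin q \<rho> i * qpoch_fin q \<sigma> i * qpoch_fin q x (m - i) * x ^ i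
            * qpoch_fin q (y * q ^ i) (m - i) / (qpoch_fin q q i * qpoch_fin q q (m - i)))"
  define D where "D = (\<lambda>i. q ^ (m - i) * qpoch_fin q \<rho> (Suc i) * qpoch_fin q \<sigma> (Suc i) * x ^ Suc i
      * qpoch_fin q x (m - i) * qpoch_fin q (y * q ^ i) (m - i)
      / (qpoch_fin q q i * qpoch_fin q q (m - i)))"
  \<comment> \<open>\<open>D i\<close> is the certificate at index \<open>i + 1\<close>. The value
    \<open>0\<close> at index \<open>0\<close> makes the lower end of the telescoping
    vanish.\<close>
  define D' where "D' = (\<lambda>i. case i of 0 \<Rightarrow> 0 | Suc i \<Rightarrow> D i)"
  \<comment> \<open>Passing from \<open>m\<close> to \<open>Suc m\<close> multiplies the claimed
    product by \<open>F / (1 - q ^ Suc m)\<close>.\<close>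
  define F where "F = (1 - x * \<rho> * q ^ m) * (1 - x * \<sigma> * q ^ m)"
  have nz: "qpoch_fin q q i \<noteq> 0" for i
    using qpoch_fin_q_nonzero nr by blast
  have nr': "1 - q * q ^ k \<noteq> 0" for k
    using nr[of k] by simp
  have step: "(1 - q ^ Suc m) * t (Suc m) i = F * t m i + D' i - D' (Suc i)" if "i \<le> m" for i
  proof -
    \<comment> \<open>Writing \<open>m = i + d\<close> removes truncated subtraction. Once a common
      factor \<open>c\<close> is taken out, a polynomial identity remains.\<close>
    from that obtain d where m: "m = i + d"
      using le_Suc_ex by blast
    show ?thesis
    proof (cases i)
      case 0
      define c where "c = qpoch_fin q x m * qpoch_fin q (y) m / qpoch_fin q q (Suc m)"
      have e1: "t (Suc m) i = c * ((1 - x * q ^ m) * (1 - y * q ^ m))"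
        unfolding t_def c_def using 0
        by (simp add: qpoch_fin_Suc[of q x] qpoch_fin_Suc[of q y] mult_ac)
      have e2: "t m i = c * (1 - q * q ^ m)"
        unfolding t_def c_def using 0 nr'[of m] by (simp add: qpoch_fin_Suc[of q q m])
      have e3: "D' i = 0"
        using 0 by (simp add: D'_def)
      have e4: "D' (Suc i) = c * (q ^ m * (1 - \<rho>) * (1 - \<sigma>) * x * (1 - q * q ^ m))"
        unfolding D_def D'_def c_def using 0 nr'[of m]
        by (simp add: qpoch_fin_Suc[of q q m] qpoch_fin_Suc[of q _ 0] mult_ac)
      have "(1 - q ^ Suc m) * ((1 - x * q ^ m) * (1 - y * q ^ m)) = F * (1 - q * q ^ m)
          - q ^ m * (1 - \<rho>) * (1 - \<sigma>) * x * (1 - q * q ^ m)"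
        unfolding F_def y_def by simp algebra
      then have "c * ((1 - q ^ Suc m) * ((1 - x * q ^ m) * (1 - y * q ^ m)))
          = c * (F * (1 - q * q ^ m) - q ^ m * (1 - \<rho>) * (1 - \<sigma>) * x * (1 - q * q ^ m))"
        by (rule arg_cong)
      then show ?thesis
        unfolding e1 e2 e3 e4 by (simp only: algebra_simps add_0_left)
    next
      case (Suc l)
      define c where "c = qpoch_fin q \<rho> (Suc l) * qpoch_fin q \<sigma> (Suc l) * x ^ Suc l * qpoch_fin q x d
          * qpoch_fin q (y * q ^ Suc l) d / (qpoch_fin q q (Suc l) * qpoch_fin q q (Suc d))"
      have e1: "t (Suc m) i = c * (1 - x * q ^ d) * (1 - y * q ^ m)"
        unfolding t_def c_def using Suc m
        by (simp add: Suc_diff_le qpoch_fin_Suc[of q x] qpoch_fin_Suc[of q "q * (y * q ^ l)"]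
             power_add mult_ac)
      have e2: "t m i = c * (1 - q * q ^ d)"
        unfolding t_def c_def using Suc m nr'[of d] nz
        by (simp add: qpoch_fin_Suc[of q q d])
      have e3: "D' i = c * q ^ Suc d * (1 - x * q ^ d) * (1 - y * q ^ l) * (1 - q * q ^ l)"
        unfolding D_def D'_def c_def using Suc m nr'[of l] nz
        by (simp add: qpoch_fin_Suc[of q q l] qpoch_fin_Suc[of q x]
              qpoch_fin_Suc_shift[of q "y * q ^ l"] mult_ac)
      have e4: "D' (Suc i) = c * q ^ d * (1 - \<rho> * q ^ Suc l) * (1 - \<sigma> * q ^ Suc l) * x * (1 - q * q ^ d)"
        unfolding D_def D'_def c_def using Suc m nr'[of d] nz
        by (simp add: qpoch_fin_Suc[of q q d] qpoch_fin_Suc[of q _ "Suc l"] mult_ac)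
      have "(1 - q ^ Suc m) * ((1 - x * q ^ d) * (1 - y * q ^ m)) = F * (1 - q * q ^ d)
          + q ^ Suc d * (1 - x * q ^ d) * (1 - y * q ^ l) * (1 - q * q ^ l)
          - q ^ d * (1 - \<rho> * q ^ Suc l) * (1 - \<sigma> * q ^ Suc l) * x * (1 - q * q ^ d)"
        unfolding F_def y_def using Suc m by (simp add: power_add algebra_simps)
      then have "c * ((1 - q ^ Suc m) * ((1 - x * q ^ d) * (1 - y * q ^ m))) = c * (F * (1 - q * q ^ d)
          + q ^ Suc d * (1 - x * q ^ d) * (1 - y * q ^ l) * (1 - q * q ^ l)
          - q ^ d * (1 - \<rho> * q ^ Suc l) * (1 - \<sigma> * q ^ Suc l) * x * (1 - q * q ^ d))"
        by (rule arg_cong)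
      then show ?thesis
        unfolding e1 e2 e3 e4 by (simp only: algebra_simps add_0_left)
    qed
  qed
  \<comment> \<open>The top index is treated apart: by truncated subtraction
    \<open>t m (Suc m)\<close> is not zero in general, so \<open>step\<close> does not extend to
    it.\<close>
  have last: "(1 - q ^ Suc m) * t (Suc m) (Suc m) = D' (Suc m)"
    using nr'[of m] nz by (simp add: t_def D'_def D_def qpoch_fin_Suc[of q q m])
  have "(1 - q ^ Suc m) * (\<Sum>i\<le>Suc m. t (Suc m) i)
      = (\<Sum>i\<le>m. (1 - q ^ Suc m) * t (Suc m) i) + (1 - q ^ Suc m) * t (Suc m) (Suc m)"
    by (simp add: sum_distrib_left distrib_left)
  also have "\<dots> = (\<Sum>i\<le>m. F * t m i + (D' i - D' (Suc i))) + D' (Suc m)"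
    unfolding last by (intro arg_cong2[where f = "(+)"] sum.cong refl) (simp only: step atMost_iff add_diff_eq)
  also have "\<dots> = F * (\<Sum>i\<le>m. t m i) + D' 0"
    by (simp add: sum.distrib sum_telescope sum_distrib_left)
  also have "\<dots> = F * (qpoch_fin q (x * \<rho>) m * qpoch_fin q (x * \<sigma>) m / qpoch_fin q q m)"
    using Suc.IH by (simp add: t_def D'_def y_def)
  finally have "(\<Sum>i\<le>Suc m. t (Suc m) i)
      = F * (qpoch_fin q (x * \<rho>) m * qpoch_fin q (x * \<sigma>) m / qpoch_fin q q m) / (1 - q ^ Suc m)"
    using nr[of m] by (simp only: nonzero_eq_divide_eq right_minus_eq mult.commute)
  also have "\<dots> = qpoch_fin q (x * \<rho>) (Suc m) * qpoch_fin q (x * \<sigma>) (Suc m) / qpoch_fin q q (Suc m)"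
    by (simp add: qpoch_fin_Suc F_def)
  finally show ?case
    by (simp add: t_def y_def)
qed

text \<open>The contiguous relation \<open>1 - A = (1 - A q^i) - A (1 - q^i)\<close> reduces the sum to two Saalschuetz sums.\<close>

lemma contiguous_saalschuetz:
  fixes q x \<rho> \<sigma> :: complex
  assumes nr: "\<And>k. q ^ Suc k \<noteq> 1"
  defines "A \<equiv> x * \<rho> * \<sigma>"
  shows "(1 - A) * (\<Sum>i\<le>m. qpoch_fin q \<rho> i * qpoch_fin q \<sigma> i * qpoch_fin q x (m - i) * x ^ i
            * qpoch_fin q (A * q ^ Suc i) (m - i) / (qpoch_fin q q i * qpoch_fin q q (m - i)))
         = (1 - A * q ^ m) * qpoch_fin q (x * \<rho>) m * qpoch_fin q (x * \<sigma>) m / qpoch_fin q q m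
           - (if m = 0 then 0 else A * x * (1 - \<rho>) * (1 - \<sigma>) * qpoch_fin q (x * \<rho> * q) (m - 1)
               * qpoch_fin q (x * \<sigma> * q) (m - 1) / qpoch_fin q q (m - 1))"
proof -
  define g where "g = (\<lambda>i. qpoch_fin q \<rho> i * qpoch_fin q \<sigma> i * qpoch_fin q x (m - i) * x ^ i
            * qpoch_fin q (A * q ^ Suc i) (m - i) / (qpoch_fin q q i * qpoch_fin q q (m - i)))"
  have nz: "qpoch_fin q q i \<noteq> 0" for i
    using qpoch_fin_q_nonzero nr by blast
  have nr': "1 - q * q ^ k \<noteq> 0" for k
    using nr[of k] by simp
  \<comment> \<open>The factor \<open>1 - A * q ^ i\<close> extends the product over
    \<open>A * q ^ Suc i\<close> by one place at the bottom, and \<open>1 - A * q ^ m\<close> splits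
    off at the top. What is left is a Saalschuetz summand.\<close>
  have g1: "(1 - A * q ^ i) * g i = (1 - A * q ^ m) *
      (qpoch_fin q \<rho> i * qpoch_fin q \<sigma> i * qpoch_fin q x (m - i) * x ^ i
            * qpoch_fin q (x * \<rho> * \<sigma> * q ^ i) (m - i) / (qpoch_fin q q i * qpoch_fin q q (m - i)))"
    if "i \<le> m" for i
  proof -
    have "(1 - A * q ^ i) * qpoch_fin q (A * q ^ Suc i) (m - i)
        = qpoch_fin q (A * q ^ i) (m - i) * (1 - A * q ^ m)"
      using qpoch_fin_Suc_shift[of q "A * q ^ i" "m - i"] qpoch_fin_Suc[of q "A * q ^ i" "m - i"] that
      by (simp add: power_add[symmetric] mult_ac)
    then show ?thesis
      by (simp add: g_def A_def)
  qed
  have S1: "(\<Sum>i\<le>m. (1 - A * q ^ i) * g i)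
      = (1 - A * q ^ m) * (qpoch_fin q (x * \<rho>) m * qpoch_fin q (x * \<sigma>) m / qpoch_fin q q m)"
    unfolding q_pfaff_saalschuetz[OF nr, symmetric] sum_distrib_left
    by (intro sum.cong refl g1) auto
  have S2: "(\<Sum>i\<le>m. (1 - q ^ i) * g i)
      = (if m = 0 then 0 else x * (1 - \<rho>) * (1 - \<sigma>) * (qpoch_fin q (x * \<rho> * q) (m - 1)
               * qpoch_fin q (x * \<sigma> * q) (m - 1) / qpoch_fin q q (m - 1)))"
  proof (cases m)
    case (Suc l)
    \<comment> \<open>The factor \<open>1 - q ^ Suc i\<close> cancels the last factor of
      \<open>qpoch_fin q q (Suc i)\<close>. The shifted summand is of Saalschuetz type with
      \<open>\<rho> * q\<close>, \<open>\<sigma> * q\<close> and \<open>l = m - 1\<close>.\<close>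
    have g2: "(1 - q ^ Suc i) * g (Suc i) = x * (1 - \<rho>) * (1 - \<sigma>) *
       (qpoch_fin q (\<rho> * q) i * qpoch_fin q (\<sigma> * q) i * qpoch_fin q x (l - i) * x ^ i
            * qpoch_fin q (x * (\<rho> * q) * (\<sigma> * q) * q ^ i) (l - i) / (qpoch_fin q q i * qpoch_fin q q (l - i)))"
      for i
      unfolding g_def A_def using Suc nz nr'[of i]
      by (simp add: qpoch_fin_Suc[of q q] qpoch_fin_Suc_shift[of q \<rho>] qpoch_fin_Suc_shift[of q \<sigma>] mult_ac)
    have "(\<Sum>i\<le>m. (1 - q ^ i) * g i) = (\<Sum>i\<le>l. (1 - q ^ Suc i) * g (Suc i))"
      unfolding Suc sum.atMost_Suc_shift by simp
    also have "\<dots> = x * (1 - \<rho>) * (1 - \<sigma>) *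
        (qpoch_fin q (x * (\<rho> * q)) l * qpoch_fin q (x * (\<sigma> * q)) l / qpoch_fin q q l)"
      unfolding g2 sum_distrib_left[symmetric] q_pfaff_saalschuetz[OF nr] by simp
    finally show ?thesis
      using Suc by (simp add: mult.assoc)
  qed auto
  have "(1 - A) * (\<Sum>i\<le>m. g i) = (\<Sum>i\<le>m. (1 - A * q ^ i) * g i) - A * (\<Sum>i\<le>m. (1 - q ^ i) * g i)"
    by (simp add: sum_distrib_left sum_subtractf[symmetric] algebra_simps)
  then show ?thesis
    unfolding S1 S2 by (auto simp: g_def mult.assoc)
qed
text \<open>The prefactor of \<open>\<alpha>' n\<close> apart from \<open>1 - a\<close>. It gets a
  name because the coefficient of \<open>\<alpha> r\<close> in the exchanged series involves it at
  both \<open>r\<close> and \<open>r + 1\<close>.\<close>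

definition bailey_weight :: "complex \<Rightarrow> complex \<Rightarrow> complex \<Rightarrow> complex \<Rightarrow> int \<Rightarrow> complex" where
  "bailey_weight q a \<rho> \<sigma> n = qpoch \<rho> q n * qpoch \<sigma> q n * (a / (\<rho> * \<sigma>)) powi n
     / (qpoch (a / \<rho>) q n * qpoch (a / \<sigma>) q n)"

section \<open>Sums over \<open>{..n}\<close> and limits at minus infinity\<close>

lemma filterlim_nat_diff_at_bot: "filterlim (\<lambda>r::int. nat (n - r)) at_top at_bot"
  unfolding filterlim_at_top eventually_at_bot_linorder
proof
  fix Z :: nat
  show "\<exists>N. \<forall>r\<le>N. Z \<le> nat (n - r)"
    by (rule exI[of _ "n - int Z"]) auto
qed

lemma filterlim_diff_int_at_bot: "filterlim (\<lambda>k::nat. n - int k) at_bot sequentially"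
  unfolding filterlim_at_bot eventually_sequentially
proof
  fix Z :: int
  show "\<exists>N. \<forall>k\<ge>N. n - int k \<le> Z"
    by (rule exI[of _ "nat (n - Z)"]) auto
qed

text \<open>Connects unordered sums, in which double series are exchanged, with the ordered series
  \<open>j = n - k\<close> of the definition of a Bailey pair.\<close>

lemma has_sum_atMost_int_iff: "(f has_sum S) {..n::int} \<longleftrightarrow> ((\<lambda>k. f (n - int k)) has_sum S) UNIV"
  by (rule has_sum_reindex_bij_witness[of _ "\<lambda>k. n - int k" "\<lambda>j. nat (n - j)"]) auto

lemma summable_on_atMost_int_tendsto_0:
  fixes f :: "int \<Rightarrow> 'a::real_normed_vector"
  assumes "(\<lambda>j. norm (f j)) summable_on {..n}"
  shows "(f \<longlongrightarrow> 0) at_bot"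
proof -
  obtain S where "((\<lambda>j. norm (f j)) has_sum S) {..n}"
    using assms by (auto simp: summable_on_def)
  then have "(\<lambda>k. norm (f (n - int k))) sums S"
    unfolding has_sum_atMost_int_iff by (rule has_sum_imp_sums)
  then have "(\<lambda>k. norm (f (n - int k))) \<longlonglongrightarrow> 0"
    by (intro summable_LIMSEQ_zero sums_summable)
  then have "((\<lambda>r. norm (f (n - int (nat (n - r))))) \<longlongrightarrow> 0) at_bot"
    by (rule filterlim_compose[OF _ filterlim_nat_diff_at_bot])
  then have "((\<lambda>r. norm (f r)) \<longlongrightarrow> 0) at_bot"
  proof (rule Lim_transform_eventually)
    show "\<forall>\<^sub>F r in at_bot. norm (f (n - int (nat (n - r)))) = norm (f r)"
      unfolding eventually_at_bot_linorder by (rule exI[of _ n]) auto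
  qed
  then show ?thesis
    by (rule tendsto_norm_zero_cancel)
qed

section \<open>q-shifted factorials with integer index\<close>

context
  fixes q :: complex
  assumes q0: "q \<noteq> 0" and q1: "norm q < 1"
begin

lemma convergent_prod_qpoch: "convergent_prod (\<lambda>j. 1 - x * q ^ j)"
proof -
  have "summable (\<lambda>j. norm (x * q ^ j))"
    using q1 by (simp add: norm_mult norm_power summable_geometric)
  then have "abs_convergent_prod (\<lambda>j. 1 - x * q ^ j)"
    by (simp add: abs_convergent_prod_conv_summable)
  then show ?thesis
    by (rule abs_convergent_prod_imp_convergent_prod)
qed

lemma qpoch_inf_eq_0_iff: "qpoch_inf x q = 0 \<longleftrightarrow> (\<exists>j. x * q ^ j = 1)"
proof -
  have "(\<lambda>j. 1 - x * q ^ j) has_prod qpoch_inf x q"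
    unfolding qpoch_inf_def using convergent_prod_qpoch by (rule convergent_prod_has_prod)
  from has_prod_eq_0_iff[OF this] show ?thesis
    by (auto simp: image_iff)
qed

lemma qpoch_inf_step: "qpoch_inf x q = (1 - x) * qpoch_inf (x * q) q"
proof -
  have lim: "(\<lambda>n. \<Prod>j\<le>n. 1 - y * q ^ j) \<longlonglongrightarrow> qpoch_inf y q" for y
    unfolding qpoch_inf_def by (rule convergent_prod_LIMSEQ[OF convergent_prod_qpoch])
  have "(\<Prod>j\<le>Suc n. 1 - x * q ^ j) = (1 - x) * (\<Prod>j\<le>n. 1 - x * q * q ^ j)" for n
    unfolding prod.atMost_Suc_shift by (simp add: mult.assoc)
  then have "(\<lambda>n. \<Prod>j\<le>Suc n. 1 - x * q ^ j) \<longlonglongrightarrow> (1 - x) * qpoch_inf (x * q) q"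
    using tendsto_mult_left[OF lim] by simp
  then show ?thesis
    using LIMSEQ_unique LIMSEQ_Suc[OF lim] by blast
qed

lemma qpoch_inf_split: "qpoch_inf x q = qpoch_fin q x m * qpoch_inf (x * q ^ m) q"
proof (induction m)
  case (Suc m)
  then show ?case
    using qpoch_inf_step[of "x * q ^ m"] by (simp add: qpoch_fin_Suc mult_ac)
qed simp

lemma q_power_neq_1: "q ^ Suc k \<noteq> 1"
proof
  assume "q ^ Suc k = 1"
  then have "norm q ^ Suc k = 1"
    by (metis norm_one norm_power)
  moreover have "norm q ^ Suc k < 1"
    using q0 q1 by (intro power_Suc_less_one) auto
  ultimately show False
    by simp
qed

lemma qpoch_inf_q_nonzero: "qpoch_inf q q \<noteq> 0"
  using q_power_neq_1 by (auto simp: qpoch_inf_eq_0_iff)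

text \<open>The hypothesis makes \<open>qpoch_inf (x * q powi k) q\<close> nonzero. At a zero of it,
  \<open>qpoch x q k\<close> would be \<open>0\<close> by the convention for division, while the
  left side need not vanish.\<close>

lemma qpoch_add_nat:
  assumes "\<And>j::nat. x * q powi (k + int j) \<noteq> 1"
  shows "qpoch x q (k + int m) = qpoch x q k * qpoch_fin q (x * q powi k) m"
proof -
  have e: "x * q powi (k + int i) = x * q powi k * q ^ i" for i
    using q0 by (simp add: power_int_add)
  have nz: "qpoch_inf (x * q powi k) q \<noteq> 0"
    unfolding qpoch_inf_eq_0_iff using assms by (auto simp: e)
  show ?thesis
    using qpoch_inf_split[of "x * q powi k" m] nz unfolding qpoch_def e by auto
qed

lemma qpoch_nat:
  assumes "\<And>j::nat. x * q ^ j \<noteq> 1"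
  shows "qpoch x q (int m) = qpoch_fin q x m"
proof -
  have "qpoch_inf x q \<noteq> 0"
    using assms by (simp add: qpoch_inf_eq_0_iff)
  then show ?thesis
    using qpoch_add_nat[of x 0 m] assms by (simp add: qpoch_def)
qed

lemma qpoch_q_nat: "qpoch q q (int m) = qpoch_fin q q m"
  by (rule qpoch_nat) (use q_power_neq_1 in simp)

lemma inverse_qpoch: "inverse (qpoch x q k) = qpoch_inf (x * q powi k) q / qpoch_inf x q"
  by (simp add: qpoch_def)

text \<open>In a reciprocal the varying infinite product stands in the numerator, so the shift holds
  at poles of \<open>qpoch\<close> too. All denominators are therefore shifted in this form.\<close>

lemma inverse_qpoch_add_nat:
  "inverse (qpoch x q k) = qpoch_fin q (x * q powi k) m * inverse (qpoch x q (k + int m))"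
proof -
  have "x * q powi (k + int m) = x * q powi k * q ^ m"
    using q0 by (simp add: power_int_add)
  then show ?thesis
    using qpoch_inf_split[of "x * q powi k" m] unfolding inverse_qpoch by (simp only: times_divide_eq_right)
qed

lemma qpoch_q_minus_1: "qpoch q q (- 1) = 0"
  using q0 qpoch_inf_eq_0_iff[of 1] by (auto simp: qpoch_def intro!: exI[of _ "0::nat"])

lemma power_int_minus_tendsto_0: "((\<lambda>r. q powi (- r)) \<longlongrightarrow> 0) at_bot"
proof -
  have "(\<lambda>k::nat. q ^ k) \<longlonglongrightarrow> 0"
    using q1 by (rule LIMSEQ_power_zero)
  moreover have "filterlim (\<lambda>r::int. nat (- r)) at_top at_bot"
    using filterlim_nat_diff_at_bot[of 0] by simp
  ultimately have "((\<lambda>r. q ^ nat (- r)) \<longlongrightarrow> 0) at_bot"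
    by (rule filterlim_compose)
  then show ?thesis
  proof (rule Lim_transform_eventually)
    show "\<forall>\<^sub>F r in at_bot. q ^ nat (- r) = q powi (- r)"
      unfolding eventually_at_bot_linorder by (rule exI[of _ 0]) (auto simp: power_int_def)
  qed
qed

text \<open>Isolates the growth as \<open>r\<close> tends to minus infinity: the second factor then
  tends to \<open>- x\<close>.\<close>

lemma one_minus_power_int: "1 - x * q powi r = q powi r * (q powi (- r) - x)"
  using q0 by (simp add: right_diff_distrib power_int_minus)


section \<open>The finite inner sum of the exchanged double series\<close>

lemma inverse_qpoch_shift_base:
  assumes "a \<noteq> 1"
  shows "inverse (qpoch (a * q) q k) = (1 - a) * inverse (qpoch a q (k + 1))"
proof -
  have "a * q powi (k + 1) = a * q * q powi k"
    using q0 by (simp add: power_int_add mult_ac)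
  then show ?thesis
    unfolding inverse_qpoch using qpoch_inf_step[of a] assms by (simp only:) simp
qed

text \<open>With \<open>j = r + i\<close>, each factor of the summand is a constant, collected in
  \<open>C\<close>, times a finite product in \<open>i\<close>. The sum is then that of
  \<open>contiguous_saalschuetz\<close> with \<open>m = n - r\<close>, and its two products turn
  back into the weights at \<open>r\<close> and \<open>r + 1\<close>.\<close>

lemma bailey_kernel:
  fixes a \<rho> \<sigma> :: complex and n r :: int
  defines "x \<equiv> a / (\<rho> * \<sigma>)"
  defines "w \<equiv> bailey_weight q a \<rho> \<sigma>"
  assumes nonzero: "a \<noteq> 0" "\<rho> \<noteq> 0" "\<sigma> \<noteq> 0"
    and a: "a \<noteq> 1" "a * q powi (2 * r) \<noteq> 1"
    and num: "\<And>k::int. \<rho> * q powi k \<noteq> 1" "\<And>k::int. \<sigma> * q powi k \<noteq> 1"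
      "\<And>k::nat. x * q ^ k \<noteq> 1"
    and "r \<le> n"
  shows "(\<Sum>j\<in>{r..n}. qpoch \<rho> q j * qpoch \<sigma> q j * qpoch x q (n - j) * x powi j
        / (qpoch q q (n - j) * (qpoch (a / \<rho>) q n * qpoch (a / \<sigma>) q n))
        / (qpoch q q (j - r) * qpoch (a * q) q (j + r)))
    = (1 - a) / (1 - a * q powi (2 * r))
        * (w r / (qpoch q q (n - r) * qpoch a q (n + r))
           - a * q powi (2 * r) * w (r + 1) / (qpoch q q (n - (r + 1)) * qpoch a q (n + (r + 1))))"
proof -
  define m where "m = nat (n - r)"
  have n: "n = r + int m"
    using \<open>r \<le> n\<close> by (simp add: m_def)
  define R S A where "R = \<rho> * q powi r" and "S = \<sigma> * q powi r" and "A = a * q powi (2 * r)"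
  have q2: "q powi (2 * r) = q powi r * q powi r"
    using q0 by (metis mult_2 power_int_add)
  \<comment> \<open>The balancing relation between the parameters that the Saalschuetz sums
    demand.\<close>
  have A: "A = x * R * S"
    using nonzero by (simp add: A_def R_def S_def x_def q2)
  have xR: "x * R = a / \<sigma> * q powi r" and xS: "x * S = a / \<rho> * q powi r"
    using nonzero by (simp_all add: x_def R_def S_def)
  have x0: "x \<noteq> 0"
    using nonzero by (simp add: x_def)
  define C where "C = qpoch \<rho> q r * qpoch \<sigma> q r * x powi r * inverse (qpoch (a / \<rho>) q n)
      * inverse (qpoch (a / \<sigma>) q n) * inverse (qpoch (a * q) q (n + r))"
  define g where "g = (\<lambda>i. qpoch_fin q R i * qpoch_fin q S i * qpoch_fin q x (m - i) * x ^ i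
            * qpoch_fin q (A * q ^ Suc i) (m - i) / (qpoch_fin q q i * qpoch_fin q q (m - i)))"
  have "A \<noteq> 1"
    using a by (simp add: A_def)
  have "(\<Sum>j\<in>{r..n}. qpoch \<rho> q j * qpoch \<sigma> q j * qpoch x q (n - j) * x powi j
        / (qpoch q q (n - j) * (qpoch (a / \<rho>) q n * qpoch (a / \<sigma>) q n))
        / (qpoch q q (j - r) * qpoch (a * q) q (j + r))) = (\<Sum>i\<le>m. C * g i)"
  proof (rule sum.reindex_bij_witness[of _ "\<lambda>i. r + int i" "\<lambda>j. nat (j - r)"])
    fix j assume j: "j \<in> {r..n}"
    define i where "i = nat (j - r)"
    have ij: "j = r + int i" "i \<le> m" "n - j = int (m - i)"
      using j by (auto simp: i_def m_def)
    have "x powi j = x powi r * x ^ i"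
      using x0 by (simp add: ij power_int_add)
    moreover have "qpoch \<rho> q j = qpoch \<rho> q r * qpoch_fin q R i" "qpoch \<sigma> q j = qpoch \<sigma> q r * qpoch_fin q S i"
      unfolding ij R_def S_def using num by (auto intro!: qpoch_add_nat)
    moreover have "qpoch x q (n - j) = qpoch_fin q x (m - i)"
      unfolding ij(3) by (rule qpoch_nat) (use num(3) in simp)
    moreover have "qpoch q q (n - j) = qpoch_fin q q (m - i)"
      unfolding ij(3) by (rule qpoch_q_nat)
    moreover have "qpoch q q (j - r) = qpoch_fin q q i"
      by (simp add: ij qpoch_q_nat)
    \<comment> \<open>Referring this denominator to the fixed index \<open>n + r\<close> leaves a
      finite product of length \<open>m - i\<close> in the numerator.\<close>
    moreover have "inverse (qpoch (a * q) q (j + r))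
        = qpoch_fin q (A * q ^ Suc i) (m - i) * inverse (qpoch (a * q) q (n + r))"
    proof -
      have "a * q * q powi (j + r) = A * q ^ Suc i"
        using q0 by (simp add: A_def ij power_int_add q2)
      moreover have "j + r + int (m - i) = n + r"
        using ij(3) by linarith
      ultimately show ?thesis
        using inverse_qpoch_add_nat[of "a * q" "j + r" "m - i"] by (simp only:)
    qed
    ultimately show "C * g (nat (j - r)) = qpoch \<rho> q j * qpoch \<sigma> q j * qpoch x q (n - j) * x powi j
        / (qpoch q q (n - j) * (qpoch (a / \<rho>) q n * qpoch (a / \<sigma>) q n))
        / (qpoch q q (j - r) * qpoch (a * q) q (j + r))"
      unfolding i_def[symmetric] g_def C_def by (simp add: divide_inverse mult_ac)
  qed (auto simp: n)
  also have "\<dots> = C * ((1 - A) * (\<Sum>i\<le>m. g i)) / (1 - A)"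
    using \<open>A \<noteq> 1\<close> by (simp add: sum_distrib_left[symmetric])
  also have "(1 - A) * (\<Sum>i\<le>m. g i)
      = (1 - A * q ^ m) * qpoch_fin q (x * R) m * qpoch_fin q (x * S) m / qpoch_fin q q m
           - (if m = 0 then 0 else A * x * (1 - R) * (1 - S) * qpoch_fin q (x * R * q) (m - 1)
               * qpoch_fin q (x * S * q) (m - 1) / qpoch_fin q q (m - 1))"
    unfolding g_def A by (rule contiguous_saalschuetz[OF q_power_neq_1])
  finally have *: "(\<Sum>j\<in>{r..n}. qpoch \<rho> q j * qpoch \<sigma> q j * qpoch x q (n - j) * x powi j
        / (qpoch q q (n - j) * (qpoch (a / \<rho>) q n * qpoch (a / \<sigma>) q n))
        / (qpoch q q (j - r) * qpoch (a * q) q (j + r)))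
      = C * ((1 - A * q ^ m) * qpoch_fin q (x * R) m * qpoch_fin q (x * S) m / qpoch_fin q q m
           - (if m = 0 then 0 else A * x * (1 - R) * (1 - S) * qpoch_fin q (x * R * q) (m - 1)
               * qpoch_fin q (x * S * q) (m - 1) / qpoch_fin q q (m - 1))) / (1 - A)" .
  \<comment> \<open>Translates between base \<open>a\<close>, belonging to the new pair relative to
    \<open>a / q\<close>, and base \<open>a * q\<close> of the given pair.\<close>
  have base: "(1 - a) * inverse (qpoch a q (n + (r + 1))) = inverse (qpoch (a * q) q (n + r))"
    using inverse_qpoch_shift_base[OF a(1), of "n + r"] by (simp add: add.assoc)
  have first: "(1 - a) * (w r / (qpoch q q (n - r) * qpoch a q (n + r)))
      = C * ((1 - A * q ^ m) * qpoch_fin q (x * R) m * qpoch_fin q (x * S) m / qpoch_fin q q m)"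
  proof -
    have "inverse (qpoch a q (n + r)) = (1 - A * q ^ m) * inverse (qpoch a q (n + (r + 1)))"
    proof -
      have "a * q powi (n + r) = A * q ^ m"
        using q0 by (simp add: A_def n power_int_add q2)
      then show ?thesis
        using inverse_qpoch_add_nat[of a "n + r" 1] by (simp add: qpoch_fin_Suc add.assoc)
    qed
    then have "(1 - a) * inverse (qpoch a q (n + r)) = (1 - A * q ^ m) * inverse (qpoch (a * q) q (n + r))"
      using base by (metis mult.left_commute)
    moreover have "inverse (qpoch (a / \<rho>) q r) = qpoch_fin q (x * S) m * inverse (qpoch (a / \<rho>) q n)"
      unfolding xS n by (rule inverse_qpoch_add_nat)
    moreover have "inverse (qpoch (a / \<sigma>) q r) = qpoch_fin q (x * R) m * inverse (qpoch (a / \<sigma>) q n)"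
      unfolding xR n by (rule inverse_qpoch_add_nat)
    moreover have "qpoch q q (n - r) = qpoch_fin q q m"
      by (simp add: n qpoch_q_nat)
    moreover have "(1 - a) * (w r / (qpoch q q (n - r) * qpoch a q (n + r)))
       = qpoch \<rho> q r * qpoch \<sigma> q r * x powi r * inverse (qpoch (a / \<rho>) q r) * inverse (qpoch (a / \<sigma>) q r)
          * inverse (qpoch q q (n - r)) * ((1 - a) * inverse (qpoch a q (n + r)))"
      by (simp add: w_def bailey_weight_def x_def divide_inverse mult_ac)
    ultimately show ?thesis
      by (simp add: C_def divide_inverse mult_ac)
  qed
  have second: "(1 - a) * (A * w (r + 1) / (qpoch q q (n - (r + 1)) * qpoch a q (n + (r + 1))))
      = C * (if m = 0 then 0 else A * x * (1 - R) * (1 - S) * qpoch_fin q (x * R * q) (m - 1)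
               * qpoch_fin q (x * S * q) (m - 1) / qpoch_fin q q (m - 1))"
  proof (cases m)
    \<comment> \<open>Here \<open>n - (r + 1) = - 1\<close>, and the reciprocal of
      \<open>qpoch q q (- 1)\<close> is \<open>0\<close>.\<close>
    case 0
    then show ?thesis
      by (simp add: n qpoch_q_minus_1)
  next
    case (Suc l)
    have n': "n = r + 1 + int l"
      using n Suc by simp
    have q': "y * q powi (r + 1) = y * q powi r * q" for y
      using q0 by (simp add: power_int_add)
    have "qpoch \<rho> q (r + 1) = qpoch \<rho> q r * (1 - R)" "qpoch \<sigma> q (r + 1) = qpoch \<sigma> q r * (1 - S)"
      using num qpoch_add_nat[of \<rho> r 1] qpoch_add_nat[of \<sigma> r 1] by (simp_all add: R_def S_def qpoch_fin_Suc)
    moreover have "inverse (qpoch (a / \<rho>) q (r + 1)) = qpoch_fin q (x * S * q) l * inverse (qpoch (a / \<rho>) q n)"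
      unfolding xS n' q'[symmetric] by (rule inverse_qpoch_add_nat)
    moreover have "inverse (qpoch (a / \<sigma>) q (r + 1)) = qpoch_fin q (x * R * q) l * inverse (qpoch (a / \<sigma>) q n)"
      unfolding xR n' q'[symmetric] by (rule inverse_qpoch_add_nat)
    moreover have "qpoch q q (n - (r + 1)) = qpoch_fin q q l"
      by (simp add: n' qpoch_q_nat)
    moreover have "x powi (r + 1) = x powi r * x"
      using x0 by (simp add: power_int_add)
    moreover have "(1 - a) * (A * w (r + 1) / (qpoch q q (n - (r + 1)) * qpoch a q (n + (r + 1))))
       = qpoch \<rho> q (r + 1) * qpoch \<sigma> q (r + 1) * A * x powi (r + 1) * inverse (qpoch (a / \<rho>) q (r + 1))
          * inverse (qpoch (a / \<sigma>) q (r + 1))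
          * inverse (qpoch q q (n - (r + 1))) * ((1 - a) * inverse (qpoch a q (n + (r + 1))))"
      by (simp add: w_def bailey_weight_def x_def divide_inverse mult_ac)
    ultimately show ?thesis
      unfolding base using Suc by (simp add: C_def divide_inverse mult_ac)
  qed
  show ?thesis
    unfolding * right_diff_distrib[of C] first[symmetric] second[symmetric] A_def[symmetric]
    by (simp only: right_diff_distrib[symmetric] times_divide_eq_left)
qed

section \<open>Growth and decay as the index tends to minus infinity\<close>

lemma qpoch_fin_tendsto: "(\<lambda>m. qpoch_fin q x m) \<longlonglongrightarrow> qpoch_inf x q"
proof -
  have "(\<lambda>n. \<Prod>j\<le>n. 1 - x * q ^ j) \<longlonglongrightarrow> qpoch_inf x q"
    unfolding qpoch_inf_def by (rule convergent_prod_LIMSEQ[OF convergent_prod_qpoch])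
  then show ?thesis
    unfolding qpoch_fin_def by (subst filterlim_sequentially_Suc[symmetric]) (simp add: lessThan_Suc_atMost)
qed

lemma qpoch_q_tendsto: "((\<lambda>r. qpoch q q (n - r)) \<longlongrightarrow> qpoch_inf q q) at_bot"
proof -
  have "((\<lambda>r. qpoch_fin q q (nat (n - r))) \<longlongrightarrow> qpoch_inf q q) at_bot"
    by (rule filterlim_compose[OF qpoch_fin_tendsto filterlim_nat_diff_at_bot])
  then show ?thesis
  proof (rule Lim_transform_eventually)
    show "\<forall>\<^sub>F r in at_bot. qpoch_fin q q (nat (n - r)) = qpoch q q (n - r)"
      unfolding eventually_at_bot_linorder
      by (rule exI[of _ n]) (auto simp: qpoch_q_nat[symmetric])
  qed
qed

text \<open>The weights at \<open>s\<close> and \<open>s + 1\<close> differ by a rational function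
  of \<open>q powi s\<close>. Cancelling \<open>q powi (2 * s)\<close> gives \<open>f\<close>, whose
  limit is finite; one more than the norm of that limit serves as \<open>K\<close>.\<close>

lemma bailey_weight_ratio_bounded:
  fixes a \<rho> \<sigma> :: complex
  assumes nonzero: "a \<noteq> 0" "\<rho> \<noteq> 0" "\<sigma> \<noteq> 0"
    and num: "\<And>k::int. \<rho> * q powi k \<noteq> 1" "\<And>k::int. \<sigma> * q powi k \<noteq> 1"
  obtains K where "K \<ge> 1"
    "\<forall>\<^sub>F s in at_bot. norm (bailey_weight q a \<rho> \<sigma> s) \<le> K * norm (bailey_weight q a \<rho> \<sigma> (s + 1))"
proof -
  define x where "x = a / (\<rho> * \<sigma>)"
  have x0: "x \<noteq> 0"
    using nonzero by (simp add: x_def)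
  define f where "f = (\<lambda>s. (q powi (- s) - a / \<rho>) * (q powi (- s) - a / \<sigma>)
      / ((q powi (- s) - \<rho>) * (q powi (- s) - \<sigma>) * x))"
  have "(f \<longlongrightarrow> (0 - a / \<rho>) * (0 - a / \<sigma>) / ((0 - \<rho>) * (0 - \<sigma>) * x)) at_bot"
    unfolding f_def using nonzero x0 by (intro tendsto_intros power_int_minus_tendsto_0) auto
  then have "((\<lambda>s. norm (f s)) \<longlongrightarrow> norm ((0 - a / \<rho>) * (0 - a / \<sigma>) / ((0 - \<rho>) * (0 - \<sigma>) * x))) at_bot"
    by (rule tendsto_norm)
  then have ev: "\<forall>\<^sub>F s in at_bot. norm (f s) < norm ((0 - a / \<rho>) * (0 - a / \<sigma>) / ((0 - \<rho>) * (0 - \<sigma>) * x)) + 1"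
    by (rule order_tendstoD) simp
  have rec: "bailey_weight q a \<rho> \<sigma> s = f s * bailey_weight q a \<rho> \<sigma> (s + 1)" for s
  proof -
    have num': "qpoch y q (s + 1) = qpoch y q s * (1 - y * q powi s)" if "\<And>k::int. y * q powi k \<noteq> 1" for y
      using that qpoch_add_nat[of y s 1] by (simp add: qpoch_fin_Suc)
    have den': "inverse (qpoch y q s) = (1 - y * q powi s) * inverse (qpoch y q (s + 1))" for y
      using inverse_qpoch_add_nat[of y s 1] by (simp add: qpoch_fin_Suc)
    have nz: "q powi (- s) - \<rho> \<noteq> 0" "q powi (- s) - \<sigma> \<noteq> 0"
      using num one_minus_power_int[of \<rho> s] one_minus_power_int[of \<sigma> s] by auto
    have "bailey_weight q a \<rho> \<sigma> s = qpoch \<rho> q s * qpoch \<sigma> q s * x powi s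
        * inverse (qpoch (a / \<rho>) q s) * inverse (qpoch (a / \<sigma>) q s)"
      by (simp add: bailey_weight_def x_def divide_inverse mult_ac)
    also have "\<dots> = qpoch \<rho> q s * qpoch \<sigma> q s * x powi s
        * (q powi s * (q powi (- s) - a / \<rho>)) * (q powi s * (q powi (- s) - a / \<sigma>))
        * inverse (qpoch (a / \<rho>) q (s + 1)) * inverse (qpoch (a / \<sigma>) q (s + 1))"
      unfolding den' one_minus_power_int by (simp only: mult_ac)
    also have "\<dots> = f s * (qpoch \<rho> q s * (q powi s * (q powi (- s) - \<rho>))
        * (qpoch \<sigma> q s * (q powi s * (q powi (- s) - \<sigma>))) * (x powi s * x)
        * inverse (qpoch (a / \<rho>) q (s + 1)) * inverse (qpoch (a / \<sigma>) q (s + 1)))"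
      using nz x0 by (simp add: f_def)
    also have "\<dots> = f s * (qpoch \<rho> q (s + 1) * qpoch \<sigma> q (s + 1) * x powi (s + 1)
        * inverse (qpoch (a / \<rho>) q (s + 1)) * inverse (qpoch (a / \<sigma>) q (s + 1)))"
      using x0 num by (simp add: num' one_minus_power_int[symmetric] power_int_add)
    finally show ?thesis
      by (simp add: bailey_weight_def x_def divide_inverse mult_ac)
  qed
  show ?thesis
  proof
    show "\<forall>\<^sub>F s in at_bot. norm (bailey_weight q a \<rho> \<sigma> s)
      \<le> (norm ((0 - a / \<rho>) * (0 - a / \<sigma>) / ((0 - \<rho>) * (0 - \<sigma>) * x)) + 1) * norm (bailey_weight q a \<rho> \<sigma> (s + 1))"
      using ev by eventually_elim (subst rec, unfold norm_mult, intro mult_right_mono, auto)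
  qed simp
qed

text \<open>Iterating the ratio bound downwards shows at most geometric growth, which a sufficiently
  high power of \<open>q powi (- r)\<close> outweighs.\<close>

lemma bailey_weight_growth:
  fixes a \<rho> \<sigma> :: complex
  assumes nonzero: "a \<noteq> 0" "\<rho> \<noteq> 0" "\<sigma> \<noteq> 0"
    and num: "\<And>k::int. \<rho> * q powi k \<noteq> 1" "\<And>k::int. \<sigma> * q powi k \<noteq> 1"
  obtains M :: nat where
    "((\<lambda>r. bailey_weight q a \<rho> \<sigma> (r + 1) * q powi (- (int M * r))) \<longlongrightarrow> 0) at_bot"
proof -
  let ?w = "bailey_weight q a \<rho> \<sigma>"
  obtain K where K: "K \<ge> 1" "\<forall>\<^sub>F s in at_bot. norm (?w s) \<le> K * norm (?w (s + 1))"
    using bailey_weight_ratio_bounded assms by blast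
  then obtain R0 where R0: "\<And>s. s \<le> R0 \<Longrightarrow> norm (?w s) \<le> K * norm (?w (s + 1))"
    unfolding eventually_at_bot_linorder by auto
  \<comment> \<open>With \<open>R\<close> at most \<open>0\<close>, the exponent \<open>- r\<close>
    below is a natural number \<open>l\<close>, and the number \<open>k = R - (r + 1)\<close> of
    iterations is at most \<open>l\<close>.\<close>
  define R where "R = min R0 0"
  define W where "W = norm (?w R)"
  have bound: "norm (?w (R - int k)) \<le> W * K ^ k" for k
  proof (induction k)
    case (Suc k)
    have "norm (?w (R - int (Suc k))) \<le> K * norm (?w (R - int (Suc k) + 1))"
      by (rule R0) (simp add: R_def)
    also have "\<dots> \<le> K * (W * K ^ k)"
      using Suc K by (intro mult_left_mono) (auto simp: algebra_simps)
    finally show ?case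
      by (simp add: mult_ac)
  qed (simp add: W_def)
  \<comment> \<open>This choice leaves a spare factor \<open>norm q\<close> per step after
    \<open>K\<close> is absorbed, so a null sequence remains as majorant.\<close>
  obtain M where M: "norm q ^ M < norm q / K"
    using real_arch_pow_inv[of "norm q / K" "norm q"] K q0 q1 by auto
  have KM: "K * norm q ^ M \<le> norm q"
    using M K by (simp add: field_simps)
  show ?thesis
  proof
    show "((\<lambda>r. ?w (r + 1) * q powi (- (int M * r))) \<longlongrightarrow> 0) at_bot"
    proof (rule Lim_null_comparison)
      show "((\<lambda>r. W * norm (q powi (- r))) \<longlongrightarrow> 0) at_bot"
        by (rule tendsto_mult_right_zero, rule tendsto_norm_zero, rule power_int_minus_tendsto_0)
      show "\<forall>\<^sub>F r in at_bot. norm (?w (r + 1) * q powi (- (int M * r))) \<le> W * norm (q powi (- r))"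
        unfolding eventually_at_bot_linorder
      proof (intro exI[of _ "R - 1"] allI impI)
        fix r assume r: "r \<le> R - 1"
        define k where "k = nat (R - (r + 1))"
        define l where "l = nat (- r)"
        have k: "r + 1 = R - int k" and l: "- r = int l" and "k \<le> l"
          using r by (auto simp: k_def l_def R_def)
        have "- (int M * r) = int M * (- r)"
          by simp
        then have e: "q powi (- (int M * r)) = (q ^ M) ^ l"
          by (simp only: l of_nat_mult[symmetric] power_int_of_nat power_mult)
        have "norm (?w (r + 1) * q powi (- (int M * r))) = norm (?w (R - int k)) * (norm q ^ M) ^ l"
          unfolding e k by (simp add: norm_mult norm_power)
        also have "\<dots> \<le> (W * K ^ l) * (norm q ^ M) ^ l"
        proof (rule mult_right_mono)
          have "W * K ^ k \<le> W * K ^ l"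
            using K \<open>k \<le> l\<close> by (intro mult_left_mono power_increasing) (auto simp: W_def)
          with bound[of k] show "norm (?w (R - int k)) \<le> W * K ^ l"
            by linarith
        qed simp
        also have "\<dots> = W * (K * norm q ^ M) ^ l"
          by (simp add: power_mult_distrib)
        also have "\<dots> \<le> W * norm q ^ l"
          using KM K by (intro mult_left_mono power_mono) (auto simp: W_def)
        also have "\<dots> = W * norm (q powi (- r))"
          by (simp add: l norm_power)
        finally show "norm (?w (r + 1) * q powi (- (int M * r))) \<le> W * norm (q powi (- r))" .
      qed
    qed
  qed
qed

text \<open>Lowering \<open>N\<close> by one multiplies the term by \<open>1 - a q^(N+r)\<close>, which grows like \<open>q^r\<close> as
  \<open>r\<close> tends to \<open>-\<infinity>\<close>. Hence convergence for all \<open>N\<close> forces decay faster than any exponential.\<close>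

lemma superexponential_decay:
  fixes \<alpha> :: "int \<Rightarrow> complex"
  assumes "a \<noteq> 0"
    and "\<And>N. ((\<lambda>r. \<alpha> r * qpoch_inf (a * q powi (N + r + 1)) q) \<longlongrightarrow> 0) at_bot"
  shows "((\<lambda>r. \<alpha> r * qpoch_inf (a * q powi (N + r + 1)) q * q powi (int M * r)) \<longlongrightarrow> 0) at_bot"
proof (induction M arbitrary: N)
  case 0
  then show ?case
    using assms(2) by simp
next
  case (Suc M)
  let ?E = "\<lambda>N M r. \<alpha> r * qpoch_inf (a * q powi (N + r + 1)) q * q powi (int M * r)"
  have lim: "((\<lambda>r. q powi (- r) - a * q powi N) \<longlongrightarrow> 0 - a * q powi N) at_bot"
    by (intro tendsto_intros power_int_minus_tendsto_0)
  have nz: "0 - a * q powi N \<noteq> 0"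
    using assms(1) q0 by simp
  \<comment> \<open>The term for \<open>N - 1\<close> has the extra factor
    \<open>q powi r * (q powi (- r) - a * q powi N)\<close>. Dividing by the bracket, whose limit is
    nonzero, keeps one more power \<open>q powi r\<close>.\<close>
  have "((\<lambda>r. ?E (N - 1) M r / (q powi (- r) - a * q powi N)) \<longlongrightarrow> 0 / (0 - a * q powi N)) at_bot"
    by (rule tendsto_divide[OF Suc.IH lim nz])
  moreover have "\<forall>\<^sub>F r in at_bot. ?E (N - 1) M r / (q powi (- r) - a * q powi N) = ?E N (Suc M) r"
    using tendsto_imp_eventually_ne[OF lim nz]
  proof eventually_elim
    case (elim r)
    have e0: "a * q powi (N + r) * q = a * q powi (N + r + 1)" "a * q powi N * q powi r = a * q powi (N + r)"
      using q0 by (simp_all add: power_int_add)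
    have e1: "qpoch_inf (a * q powi (N - 1 + r + 1)) q
        = q powi r * (q powi (- r) - a * q powi N) * qpoch_inf (a * q powi (N + r + 1)) q"
      using qpoch_inf_step[of "a * q powi (N + r)"] one_minus_power_int[of "a * q powi N" r]
      unfolding e0 by simp
    have e2: "q powi (int (Suc M) * r) = q powi r * q powi (int M * r)"
      using q0 by (simp add: power_int_add[symmetric] algebra_simps)
    show ?case
      unfolding e1 e2 using elim by simp
  qed
  ultimately show ?case
    using Lim_transform_eventually by force
qed

text \<open>The boundary term of the summation by parts that turns \<open>\<alpha>'\<close> back into \<open>\<alpha>\<close>.\<close>

lemma bailey_boundary_tendsto_0:
  fixes a \<rho> \<sigma> :: complex and \<alpha> :: "int \<Rightarrow> complex"
  assumes nonzero: "a \<noteq> 0" "\<rho> \<noteq> 0" "\<sigma> \<noteq> 0"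
    and a: "\<And>k::nat. a * q ^ k \<noteq> 1"
    and num: "\<And>k::int. \<rho> * q powi k \<noteq> 1" "\<And>k::int. \<sigma> * q powi k \<noteq> 1"
    and conv: "\<And>n. (\<lambda>j. norm (\<alpha> j / (qpoch q q (n - j) * qpoch (a * q) q (n + j)))) summable_on {..n}"
  shows "((\<lambda>r. \<alpha> r * ((1 - a) / (1 - a * q powi (2 * r)) * (a * q powi (2 * r) * bailey_weight q a \<rho> \<sigma> (r + 1)
      / (qpoch q q (n - (r + 1)) * qpoch a q (n + (r + 1)))))) \<longlongrightarrow> 0) at_bot"
proof -
  have nz: "qpoch_inf (a * q) q \<noteq> 0" "qpoch_inf a q \<noteq> 0"
    using a by (auto simp: qpoch_inf_eq_0_iff mult.assoc simp flip: power_Suc)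
  \<comment> \<open>The terms of the series for \<open>\<beta>\<close> at \<open>N\<close> tend to
    \<open>0\<close>. Multiplying by \<open>qpoch q q (N - r)\<close>, which converges, and by a
    constant clears the denominators.\<close>
  have lim: "((\<lambda>r. \<alpha> r * qpoch_inf (a * q powi (N + r + 1)) q) \<longlongrightarrow> 0) at_bot" for N
  proof -
    let ?f = "\<lambda>j. \<alpha> j / (qpoch q q (N - j) * qpoch (a * q) q (N + j))"
    have "(?f \<longlongrightarrow> 0) at_bot"
      by (rule summable_on_atMost_int_tendsto_0[OF conv])
    then have "((\<lambda>r. ?f r * qpoch q q (N - r) * qpoch_inf (a * q) q)
        \<longlongrightarrow> 0 * qpoch_inf q q * qpoch_inf (a * q) q) at_bot"
      by (intro tendsto_intros qpoch_q_tendsto)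
    moreover have "\<forall>\<^sub>F r in at_bot. ?f r * qpoch q q (N - r) * qpoch_inf (a * q) q
        = \<alpha> r * qpoch_inf (a * q powi (N + r + 1)) q"
      using tendsto_imp_eventually_ne[OF qpoch_q_tendsto[of N] qpoch_inf_q_nonzero]
    proof eventually_elim
      case (elim r)
      have "a * q * q powi (N + r) = a * q powi (N + r + 1)"
        using q0 by (simp add: power_int_add)
      from arg_cong[OF this, of "\<lambda>y. qpoch_inf y q"] have "inverse (qpoch (a * q) q (N + r)) * qpoch_inf (a * q) q = qpoch_inf (a * q powi (N + r + 1)) q"
        unfolding inverse_qpoch using nz by simp
      moreover have "?f r * qpoch q q (N - r) * qpoch_inf (a * q) q
          = \<alpha> r * (inverse (qpoch (a * q) q (N + r)) * qpoch_inf (a * q) q)"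
        using elim by (simp add: divide_inverse)
      ultimately show ?case
        by simp
    qed
    ultimately show ?thesis
      using Lim_transform_eventually by force
  qed
  obtain M where M: "((\<lambda>r. bailey_weight q a \<rho> \<sigma> (r + 1) * q powi (- (int M * r))) \<longlongrightarrow> 0) at_bot"
    using bailey_weight_growth[OF nonzero num] by blast
  have decay: "((\<lambda>r. \<alpha> r * qpoch_inf (a * q powi (n + r + 1)) q * q powi (int M * r)) \<longlongrightarrow> 0) at_bot"
    by (rule superexponential_decay[OF nonzero(1) lim])
  \<comment> \<open>This is \<open>a * q powi (2 * r) / (1 - a * q powi (2 * r))\<close> with
    numerator and denominator divided by \<open>q powi (2 * r)\<close>.\<close>
  have ratio: "((\<lambda>r. a / ((q powi (- r)) ^ 2 - a)) \<longlongrightarrow> a / (0 ^ 2 - a)) at_bot"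
    using nonzero by (intro tendsto_intros power_int_minus_tendsto_0) auto
  \<comment> \<open>The inserted powers with exponents \<open>int M * r\<close> and
    \<open>- (int M * r)\<close> cancel: the decay of \<open>\<alpha>\<close> pays for the growth of
    the weight, and the other factors converge.\<close>
  have "((\<lambda>r. \<alpha> r * qpoch_inf (a * q powi (n + r + 1)) q * q powi (int M * r)
      * (bailey_weight q a \<rho> \<sigma> (r + 1) * q powi (- (int M * r))) * (a / ((q powi (- r)) ^ 2 - a))
      * ((1 - a) / qpoch_inf a q) / qpoch q q (n - 1 - r))
     \<longlongrightarrow> 0 * 0 * (a / (0 ^ 2 - a)) * ((1 - a) / qpoch_inf a q) / qpoch_inf q q) at_bot"
    by (intro tendsto_mult[OF _ tendsto_const] tendsto_divide tendsto_mult[OF _ ratio] tendsto_mult[OF decay M]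
        qpoch_q_tendsto qpoch_inf_q_nonzero)
  moreover have "\<alpha> r * qpoch_inf (a * q powi (n + r + 1)) q * q powi (int M * r)
      * (bailey_weight q a \<rho> \<sigma> (r + 1) * q powi (- (int M * r))) * (a / ((q powi (- r)) ^ 2 - a))
      * ((1 - a) / qpoch_inf a q) / qpoch q q (n - 1 - r)
    = \<alpha> r * ((1 - a) / (1 - a * q powi (2 * r)) * (a * q powi (2 * r) * bailey_weight q a \<rho> \<sigma> (r + 1)
      / (qpoch q q (n - (r + 1)) * qpoch a q (n + (r + 1)))))" for r
  proof -
    define t where "t = q powi r"
    have t: "t \<noteq> 0" "q powi (- r) = 1 / t" "q powi (2 * r) = t ^ 2"
      using q0 by (simp_all add: t_def power_int_minus divide_inverse power_int_mult mult.commute[of 2])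
    have 1: "a / ((q powi (- r)) ^ 2 - a) = a * q powi (2 * r) / (1 - a * q powi (2 * r))"
      unfolding t(2,3) using t(1) by (simp add: field_simps)
    have 2: "q powi (int M * r) * q powi (- (int M * r)) = 1"
      using q0 by (simp add: power_int_minus)
    have 3: "inverse (qpoch a q (n + (r + 1))) = qpoch_inf (a * q powi (n + r + 1)) q / qpoch_inf a q"
      unfolding inverse_qpoch by (simp add: add.assoc)
    have 4: "n - (r + 1) = n - 1 - r"
      by simp
    have "\<alpha> r * qpoch_inf (a * q powi (n + r + 1)) q * q powi (int M * r)
      * (bailey_weight q a \<rho> \<sigma> (r + 1) * q powi (- (int M * r))) * (a / ((q powi (- r)) ^ 2 - a))
      * ((1 - a) / qpoch_inf a q) / qpoch q q (n - 1 - r)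
      = \<alpha> r * (bailey_weight q a \<rho> \<sigma> (r + 1) * (a / ((q powi (- r)) ^ 2 - a)) * (1 - a)
         * inverse (qpoch a q (n + (r + 1))) / qpoch q q (n - (r + 1)))
         * (q powi (int M * r) * q powi (- (int M * r)))"
      unfolding 3 4 by (simp only: divide_inverse mult_ac)
    then show ?thesis
      unfolding 1 2 by (simp add: divide_inverse mult_ac)
  qed
  ultimately show ?thesis
    by simp
qed

end

section \<open>Exchange of summations and summation by parts\<close>

theorem theorem1p8:
  fixes a q \<rho> \<sigma> :: complex and \<alpha> \<beta> \<alpha>' \<beta>' :: "int \<Rightarrow> complex"
  assumes q: "q \<noteq> 0" "norm q < 1"
    and nonzero: "a \<noteq> 0" "\<rho> \<noteq> 0" "\<sigma> \<noteq> 0"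
    and generic_a: "\<And>k::nat. a * q ^ k \<noteq> 1" "\<And>k::int. a * q powi (2 * k) \<noteq> 1"
    and generic_num: "\<And>k::int. \<rho> * q powi k \<noteq> 1" "\<And>k::int. \<sigma> * q powi k \<noteq> 1"
      "\<And>k::nat. a / (\<rho> * \<sigma>) * q ^ k \<noteq> 1"
    and generic_den: "\<And>k::nat. a / \<rho> * q ^ k \<noteq> 1" "\<And>k::nat. a / \<sigma> * q ^ k \<noteq> 1"
    and pair: "bilateral_bailey_pair q a \<alpha> \<beta>"
    and \<alpha>': "\<And>n. \<alpha>' n =
      qpoch \<rho> q n * qpoch \<sigma> q n * (a / (\<rho> * \<sigma>)) powi n
        / (qpoch (a / \<rho>) q n * qpoch (a / \<sigma>) q n) * (1 - a)
        * (\<alpha> n / (1 - a * q powi (2 * n))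
           - a * q powi (2 * n - 2) * \<alpha> (n - 1) / (1 - a * q powi (2 * n - 2)))"
    and \<beta>': "\<And>n. \<beta>' n = (\<Sum>\<^sub>\<infinity>j\<in>{..n}.
      qpoch \<rho> q j * qpoch \<sigma> q j * qpoch (a / (\<rho> * \<sigma>)) q (n - j) * (a / (\<rho> * \<sigma>)) powi j
        / (qpoch q q (n - j) * (qpoch (a / \<rho>) q n * qpoch (a / \<sigma>) q n)) * \<beta> j)"
    and conv_pair: "\<And>n.
      (\<lambda>j. norm (\<alpha> j / (qpoch q q (n - j) * qpoch (a * q) q (n + j)))) summable_on {..n}"
    and conv_double: "\<And>n. (\<lambda>(j, r). norm (
      qpoch \<rho> q j * qpoch \<sigma> q j * qpoch (a / (\<rho> * \<sigma>)) q (n - j) * (a / (\<rho> * \<sigma>)) powi j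
        / (qpoch q q (n - j) * (qpoch (a / \<rho>) q n * qpoch (a / \<sigma>) q n))
        * (\<alpha> r / (qpoch q q (j - r) * qpoch (a * q) q (j + r)))))
      summable_on {(j, r). r \<le> j \<and> j \<le> n}"
  shows "bilateral_bailey_pair q (a / q) \<alpha>' \<beta>'"
proof -
  let ?w = "bailey_weight q a \<rho> \<sigma>"
  \<comment> \<open>Absolute convergence identifies the ordered series in the pair with an unordered
    sum.\<close>
  have \<beta>: "\<beta> j = (\<Sum>\<^sub>\<infinity>r\<in>{..j}. \<alpha> r / (qpoch q q (j - r) * qpoch (a * q) q (j + r)))" for j
  proof -
    let ?f = "\<lambda>r. \<alpha> r / (qpoch q q (j - r) * qpoch (a * q) q (j + r))"
    have "?f summable_on {..j}"
      using conv_pair[of j] by (rule abs_summable_summable)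
    then have "(?f has_sum infsum ?f {..j}) {..j}"
      by (rule has_sum_infsum)
    then have "(\<lambda>k. ?f (j - int k)) sums infsum ?f {..j}"
      unfolding has_sum_atMost_int_iff by (rule has_sum_imp_sums)
    moreover have "(\<lambda>k. ?f (j - int k)) sums \<beta> j"
      using pair by (simp add: bilateral_bailey_pair_def Let_def)
    ultimately show ?thesis
      using sums_unique2 by blast
  qed
  have "(\<lambda>k::nat. let j = n - int k in \<alpha>' j / (qpoch q q (n - j) * qpoch (a / q * q) q (n + j))) sums \<beta>' n" for n
  proof -
    define c where "c = (\<lambda>j. qpoch \<rho> q j * qpoch \<sigma> q j * qpoch (a / (\<rho> * \<sigma>)) q (n - j) * (a / (\<rho> * \<sigma>)) powi j
        / (qpoch q q (n - j) * (qpoch (a / \<rho>) q n * qpoch (a / \<sigma>) q n)))"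
    define T where "T = (\<lambda>j r. c j * (\<alpha> r / (qpoch q q (j - r) * qpoch (a * q) q (j + r))))"
    define U where "U = (\<lambda>r. \<alpha> r * ((1 - a) / (1 - a * q powi (2 * r))
        * (?w r / (qpoch q q (n - r) * qpoch a q (n + r)))))"
    define V where "V = (\<lambda>r. \<alpha> r * ((1 - a) / (1 - a * q powi (2 * r)) * (a * q powi (2 * r) * ?w (r + 1)
        / (qpoch q q (n - (r + 1)) * qpoch a q (n + (r + 1))))))"
    \<comment> \<open>Absolute summability over the whole triangle \<open>r \<le> j \<le> n\<close>
      justifies the exchange.\<close>
    have T: "(\<lambda>(j, r). T j r) summable_on (SIGMA j:{..n}. {..j})"
    proof -
      have "{(j, r). r \<le> j \<and> j \<le> n} = (SIGMA j:{..n}. {..j})"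
        by auto
      with conv_double[of n] have "(\<lambda>x. norm (case x of (j, r) \<Rightarrow> T j r)) summable_on (SIGMA j:{..n}. {..j})"
        by (simp add: T_def c_def case_prod_unfold)
      then show ?thesis
        by (rule abs_summable_summable)
    qed
    have swap: "((\<lambda>(r, j). T j r) has_sum S) (SIGMA r:{..n}. {r..n})
        \<longleftrightarrow> ((\<lambda>(j, r). T j r) has_sum S) (SIGMA j:{..n}. {..j})" for S
      by (rule has_sum_reindex_bij_witness[of _ "\<lambda>(j, r). (r, j)" "\<lambda>(r, j). (j, r)"]) auto
    have T': "(\<lambda>(r, j). T j r) summable_on (SIGMA r:{..n}. {r..n})"
      using T by (simp add: summable_on_def swap)
    have inner: "(\<Sum>\<^sub>\<infinity>j\<in>{r..n}. T j r) = U r - V r" if "r \<in> {..n}" for r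
    proof -
      have "(\<Sum>\<^sub>\<infinity>j\<in>{r..n}. T j r) = \<alpha> r * (\<Sum>j\<in>{r..n}. c j / (qpoch q q (j - r) * qpoch (a * q) q (j + r)))"
        by (simp add: T_def sum_distrib_left mult_ac)
      also have "\<dots> = U r - V r"
        unfolding c_def U_def V_def
        by (subst bailey_kernel[OF q nonzero _ generic_a(2) generic_num])
          (use generic_a(1)[of 0] that in \<open>auto simp: right_diff_distrib\<close>)
      finally show ?thesis .
    qed
    have "\<beta>' n = (\<Sum>\<^sub>\<infinity>j\<in>{..n}. \<Sum>\<^sub>\<infinity>r\<in>{..j}. T j r)"
      unfolding \<beta>' \<beta> T_def c_def infsum_cmult_right' ..
    also have "\<dots> = infsum (\<lambda>(j, r). T j r) (SIGMA j:{..n}. {..j})"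
      by (rule infsum_Sigma'_banach[OF T])
    also have "\<dots> = infsum (\<lambda>(r, j). T j r) (SIGMA r:{..n}. {r..n})"
      using swap has_sum_infsum[OF T] by (metis infsumI)
    also have "\<dots> = (\<Sum>\<^sub>\<infinity>r\<in>{..n}. \<Sum>\<^sub>\<infinity>j\<in>{r..n}. T j r)"
      by (rule infsum_Sigma'_banach[OF T', symmetric])
    also have "\<dots> = (\<Sum>\<^sub>\<infinity>r\<in>{..n}. U r - V r)"
      by (rule infsum_cong[OF inner])
    finally have \<beta>'_eq: "\<beta>' n = (\<Sum>\<^sub>\<infinity>r\<in>{..n}. U r - V r)" .
    have "(\<lambda>r. U r - V r) summable_on {..n}"
      by (rule iffD1[OF summable_on_cong[OF inner] summable_on_Sigma_banach[OF T']])
    then have "((\<lambda>r. U r - V r) has_sum \<beta>' n) {..n}"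
      unfolding \<beta>'_eq by (rule has_sum_infsum)
    then have "(\<lambda>k. U (n - int k) - V (n - int k)) sums \<beta>' n"
      unfolding has_sum_atMost_int_iff by (rule has_sum_imp_sums)
    then have lim: "(\<lambda>L. \<Sum>k<L. U (n - int k) - V (n - int k)) \<longlonglongrightarrow> \<beta>' n"
      by (simp add: sums_def)
    have "(V \<longlongrightarrow> 0) at_bot"
      unfolding V_def
      by (rule bailey_boundary_tendsto_0[OF q nonzero generic_a(1) generic_num(1,2) conv_pair])
    then have "(\<lambda>L. V (n - int L)) \<longlonglongrightarrow> 0"
      by (rule filterlim_compose[OF _ filterlim_diff_int_at_bot])
    with lim have lim': "(\<lambda>L. (\<Sum>k<L. U (n - int k) - V (n - int k)) - V (n - int L)) \<longlonglongrightarrow> \<beta>' n - 0"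
      by (rule tendsto_diff)
    \<comment> \<open>\<open>V\<close> is indexed by its \<open>\<alpha>\<close> and carries the
      weight one place higher, so \<open>V (r - 1)\<close> has the weight at
      \<open>r\<close>.\<close>
    have \<alpha>'_eq: "\<alpha>' r / (qpoch q q (n - r) * qpoch a q (n + r)) = U r - V (r - 1)" for r
    proof -
      have "\<alpha>' r = ?w r * (1 - a) * (\<alpha> r / (1 - a * q powi (2 * r))
          - a * q powi (2 * (r - 1)) * \<alpha> (r - 1) / (1 - a * q powi (2 * (r - 1))))"
        unfolding \<alpha>' bailey_weight_def by (simp add: right_diff_distrib)
      then show ?thesis
        unfolding U_def V_def diff_add_cancel by (simp only: divide_inverse ring_distribs mult_ac inverse_mult_distrib)
    qed
    \<comment> \<open>The upper boundary term contains the reciprocal of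
      \<open>qpoch q q (- 1)\<close>, which is \<open>0\<close>.\<close>
    have V0: "V n = 0"
      by (simp add: V_def qpoch_q_minus_1[OF q])
    \<comment> \<open>The regrouping takes place in the partial sums, where only the end terms
      \<open>V n = 0\<close> and \<open>V (n - int L)\<close> appear; the latter tends to
      \<open>0\<close>.\<close>
    have "(\<Sum>k<L. U (n - int k) - V (n - int k - 1))
        = (\<Sum>k<L. U (n - int k) - V (n - int k)) - V (n - int L)" for L
    proof (induction L)
      case (Suc L)
      then show ?case
        by (simp add: algebra_simps)
    qed (simp add: V0)
    then have "(\<lambda>k. U (n - int k) - V (n - int k - 1)) sums \<beta>' n"
      using lim' by (simp add: sums_def)
    then show ?thesis
      using q(1) by (simp only: \<alpha>'_eq[symmetric] Let_def nonzero_divide_eq_eq times_divide_eq_left) simp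
  qed
  then show ?thesis
    by (simp add: bilateral_bailey_pair_def)
qed

end
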